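(* If $T$ is a $3$-$1$ tree on $n$ vertices, then \[\operatorname{Z}(G_T) = \operatorname{Z}(T) + n + 2 = \alpha(G_T) + 1.\]
   Context: All graphs are simple, finite and undirected. A $3$-$1$ tree is a tree in which every vertex has degree either $1$ or $3$; a leaf of a tree is a vertex of degree $1$. $\alpha(G)$ is the independence number of $G$. Zero forcing: given a set $B\subseteq V(G)$ of initially blue vertices (the rest white), if a blue vertex has exactly one white neighbor $w$, it can force $w$ to become blue; this rule is applied repeatedly. $B$ is a zero forcing set if all vertices can eventually become blue. $\operatorname{Z}(G)$ is the minimum cardinality of a zero forcing set of $G$. Replacement: if $G$ is a graph, $v\in V(G)$, and $H$ is a graph with exactly $\deg_G(v)$ vertices of degree $2$ and all other vertices of degree $3$, then $H$ replaces $v$ in $G$ by deleting $v$, adding a disjoint copy of $H$, and adding a matching between the neighbors of $v$ and the degree $2$ vertices of $H$. $G_T$ is the graph obtained from the tree $T$ by replacing every leaf of $T$ with $K_4$ with one edge subdivided. Explicitly, each leaf $\ell_i$ of $T$ is replaced by five vertices $\ell_i',a_i,b_i,c_i,d_i$ with edges $\ell_i'a_i,\ \ell_i'b_i,\ a_ic_i,\ a_id_i,\ b_ic_i,\ b_id_i,\ c_id_i$, and $\ell_i'$ is joined to the vertex which takes the place of the neighbor of $\ell_i$ in $T$ (if that neighbor is itself a leaf $\ell_j$, then $\ell_i'$ is joined to $\ell_j'$). *)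

theory Defs
  imports "Graph_Theory.Graph_Theory"
begin

text \<open>
  A simple finite undirected graph is a \<^locale>\<open>pair_graph\<close>: a finite vertex set with a symmetric
  irreflexive arc relation, each undirected edge being the pair of its two orientations. Hence
  \<^const>\<open>out_degree\<close> is the degree of a vertex.

  The predicate \<^const>\<open>tree\<close> is not usable for such graphs: \<^const>\<open>pre_digraph.cycle\<close>
  counts an edge traversed back and forth as a cycle. The closed walks without
  repeated vertices that are cycles of the undirected graph are those of length at least 3.
\<close>

definition undirected_tree :: "'a pair_pre_digraph \<Rightarrow> bool" where
  "undirected_tree T \<longleftrightarrow> pair_graph T \<and> connected (with_proj T) \<and>
     \<not> (\<exists>p. pre_digraph.cycle (with_proj T) p \<and> 3 \<le> length p)"

definition three_one_tree :: "'a pair_pre_digraph \<Rightarrow> bool" where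
  "three_one_tree T \<longleftrightarrow> undirected_tree T \<and>
     (\<forall>v \<in> pverts T. out_degree (with_proj T) v = 1 \<or> out_degree (with_proj T) v = 3)"

definition leaves :: "'a pair_pre_digraph \<Rightarrow> 'a set" where
  "leaves T = {v \<in> pverts T. out_degree (with_proj T) v = 1}"

definition independent_set :: "'a pair_pre_digraph \<Rightarrow> 'a set \<Rightarrow> bool" where
  "independent_set G S \<longleftrightarrow> S \<subseteq> pverts G \<and> (\<forall>u \<in> S. \<forall>v \<in> S. (u, v) \<notin> parcs G)"

definition independence_number :: "'a pair_pre_digraph \<Rightarrow> nat" where
  "independence_number G = Max (card ` {S. independent_set G S})"

text \<open>One application of the colour change rule, taking the set \<open>B\<close> of blue vertices to \<open>B'\<close>.\<close>

definition force_step :: "'a pair_pre_digraph \<Rightarrow> 'a set \<Rightarrow> 'a set \<Rightarrow> bool" where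
  "force_step G B B' \<longleftrightarrow>
     (\<exists>u \<in> B. \<exists>w. {x. (u, x) \<in> parcs G \<and> x \<notin> B} = {w} \<and> B' = insert w B)"

definition zero_forcing_set :: "'a pair_pre_digraph \<Rightarrow> 'a set \<Rightarrow> bool" where
  "zero_forcing_set G B \<longleftrightarrow> B \<subseteq> pverts G \<and> (force_step G)\<^sup>*\<^sup>* B (pverts G)"

definition zero_forcing_number :: "'a pair_pre_digraph \<Rightarrow> nat" where
  "zero_forcing_number G = Min (card ` {B. zero_forcing_set G B})"

text \<open>
  Replacement of the leaves of a tree. A vertex \<open>v\<close> of the tree that is not a leaf survives as
  \<open>Kept v\<close>; a leaf \<open>l\<close> gives way to a copy of \<open>K\<^sub>4\<close> on \<open>VA l, VB l, VC l, VD l\<close> whose edge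
  between \<open>VA l\<close> and \<open>VB l\<close> is subdivided by the vertex \<open>Attach l\<close>.
\<close>

datatype 'a repl_vertex =
  Kept 'a | Attach 'a | VA 'a | VB 'a | VC 'a | VD 'a

definition tree_place :: "'a pair_pre_digraph \<Rightarrow> 'a \<Rightarrow> 'a repl_vertex" where
  "tree_place T v = (if v \<in> leaves T then Attach v else Kept v)"

definition gadget_arcs :: "'a \<Rightarrow> 'a repl_vertex rel" where
  "gadget_arcs l = {(Attach l, VA l), (Attach l, VB l), (VA l, VC l), (VA l, VD l),
     (VB l, VC l), (VB l, VD l), (VC l, VD l)}"

definition replace_leaves :: "'a pair_pre_digraph \<Rightarrow> 'a repl_vertex pair_pre_digraph" where
  "replace_leaves T =
    \<lparr> pverts = tree_place T ` pverts T \<union> (\<Union>l \<in> leaves T. {VA l, VB l, VC l, VD l}),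
      parcs = (\<lambda>(u, v). (tree_place T u, tree_place T v)) ` parcs T
        \<union> (\<Union>l \<in> leaves T. gadget_arcs l \<union> (gadget_arcs l)\<inverse>) \<rparr>"

lemma tree_place_inject [simp]: "tree_place T u = tree_place T v \<longleftrightarrow> u = v"
  by (auto simp: tree_place_def)

lemma pair_graph_replace_leaves:
  assumes "pair_graph T"
  shows "pair_graph (replace_leaves T)"
proof -
  interpret pair_graph T by fact
  have fin: "finite (leaves T)"
    unfolding leaves_def using pair_finite_verts by auto
  have att: "l \<in> leaves T \<Longrightarrow> Attach l \<in> tree_place T ` pverts T" for l
    by (auto simp: tree_place_def leaves_def image_iff intro!: bexI[of _ l])
  show ?thesis
  proof
    fix e assume "e \<in> parcs (replace_leaves T)"
    then show "fst e \<in> pverts (replace_leaves T)" "snd e \<in> pverts (replace_leaves T)"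
      using att by (auto simp: replace_leaves_def gadget_arcs_def dest: in_arcsD1 in_arcsD2)
  next
    show "finite (pverts (replace_leaves T))"
      using fin pair_finite_verts by (auto simp: replace_leaves_def)
    show "finite (parcs (replace_leaves T))"
      using fin pair_finite_arcs by (auto simp: replace_leaves_def gadget_arcs_def)
  next
    fix e assume "e \<in> parcs (replace_leaves T)"
    then show "fst e \<noteq> snd e"
      by (auto simp: replace_leaves_def gadget_arcs_def dest: no_loops)
  next
    show "symmetric (with_proj (replace_leaves T))"
      unfolding symmetric_def sym_def with_proj_simps replace_leaves_def
      by (force dest: arcs_symmetric)
  qed
qed

lemma zero_forcing_set_pverts: "zero_forcing_set G (pverts G)"
  by (simp add: zero_forcing_set_def)

lemma independent_set_empty: "independent_set G {}"
  by (simp add: independent_set_def)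

end

theory Submission
  imports Defs
begin

text \<open>
  Let \<open>S\<close> be a largest independent set of degree-3 vertices of \<open>T\<close>, let \<open>L\<close> be the set of leaves,
  and write \<open>G\<close> for the graph obtained by replacing them. All three quantities are determined
  by \<open>|S|\<close> and \<open>|L|\<close>:
  the zero forcing number of \<open>T\<close> is \<open>|S| + 1\<close>, that of \<open>G\<close> exceeds it by \<open>2 |L|\<close>, and the
  independence number of \<open>G\<close> is \<open>|S| + 2 |L|\<close>. Counting degrees gives \<open>2 |L| = n + 2\<close>.

  \<^emph>\<open>The tree, lower bound.\<close> Starting from a zero forcing set \<open>B\<close>, the \<open>n - |B|\<close> forces run along
  different edges, so \<open>|B| - 1\<close> of the \<open>n - 1\<close> edges carry no force. A vertex forces at most
  once and is forced at most once, so a vertex of degree 3 has an edge without a force; for the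
  vertices of an independent set these edges differ (\<open>independent_degree_three_bound\<close>).

  \<^emph>\<open>The tree, upper bound.\<close> Root \<open>T\<close> at a leaf and go upwards, putting an internal vertex into \<open>I\<close>
  if neither of its children is in \<open>I\<close>. Then \<open>I\<close> is independent. Every internal vertex outside \<open>I\<close>
  has a child in \<open>I\<close>, so deleting the edge from each vertex of \<open>I\<close> to its parent leaves \<open>|I| + 1\<close>
  paths. Choosing one end of each path appropriately gives a zero forcing set (\<open>branch_forcing\<close>).

  \<^emph>\<open>The replacement.\<close> In the copy of the subdivided \<open>K\<^sub>4\<close> at a leaf, both pairs of twins \<open>a, b\<close> and
  \<open>c, d\<close> must be hit by a zero forcing set of \<open>G\<close>. Two blue vertices per copy therefore are
  necessary, and one from each pair suffices to make the copy act like the leaf that it replaces: it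
  turns blue once its attaching vertex is blue. A third blue vertex corresponds to a leaf of \<open>T\<close> that is blue
  at the start. An independent set meets each copy in at most two vertices, and \<open>a, b\<close>
  are two that do not interfere with the rest of \<open>G\<close>.

  Zero forcing is handled by its closed sets. A set is called stalled if none of its vertices has
  exactly one neighbour outside of it; \<open>B\<close> is zero forcing iff no proper stalled subset
  contains it. This removes the order of the forces from all arguments except the counting of edges.
\<close>

section \<open>Zero forcing by stalled sets\<close>

definition neighbours :: "'a pair_pre_digraph \<Rightarrow> 'a \<Rightarrow> 'a set" where
  "neighbours G u = {w. (u, w) \<in> parcs G}"

definition stalled :: "'a pair_pre_digraph \<Rightarrow> 'a set \<Rightarrow> bool" where
  "stalled G C \<longleftrightarrow> C \<subseteq> pverts G \<and> (\<forall>u\<in>C. \<forall>w. neighbours G u - C \<noteq> {w})"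

lemma stalled_forces:
  assumes "stalled G C" "u \<in> C" "w \<in> neighbours G u" "neighbours G u - {w} \<subseteq> C"
  shows "w \<in> C"
proof (rule ccontr)
  assume "w \<notin> C"
  then have "neighbours G u - C = {w}"
    using assms(3,4) by blast
  then show False
    using assms(1,2) by (auto simp: stalled_def)
qed

context pair_graph
begin

lemma neighbours_subset: "neighbours G u \<subseteq> pverts G"
  by (auto simp: neighbours_def dest: in_arcsD2)

lemma finite_neighbours: "finite (neighbours G u)"
  by (rule finite_subset[OF neighbours_subset pair_finite_verts])

lemma neighbours_sym: "w \<in> neighbours G u \<longleftrightarrow> u \<in> neighbours G w"
  by (auto simp: neighbours_def dest: arcs_symmetric)

lemma neighbours_irrefl: "u \<notin> neighbours G u"
  by (auto simp: neighbours_def dest: no_loops')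

lemma out_degree_eq_card_neighbours: "out_degree (with_proj G) u = card (neighbours G u)"
proof -
  have "out_arcs (with_proj G) u = Pair u ` neighbours G u"
    by (auto simp: out_arcs_def neighbours_def)
  then show ?thesis
    by (simp add: out_degree_def card_image inj_on_def)
qed

lemma card_parcs: "card (parcs G) = (\<Sum>u\<in>pverts G. card (neighbours G u))"
proof -
  have "parcs G = Sigma (pverts G) (neighbours G)"
    by (auto simp: neighbours_def dest: in_arcsD1)
  then show ?thesis
    using pair_finite_verts finite_neighbours by simp
qed

lemma force_steps_within_stalled:
  assumes "(force_step G)\<^sup>*\<^sup>* B B'" "stalled G C" "B \<subseteq> C"
  shows "B' \<subseteq> C"
  using assms(1)
proof (induction rule: rtranclp_induct)
  case base
  show ?case by (fact assms(3))
next
  case (step B1 B2)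
  then obtain u w where uw: "u \<in> B1" "{x. (u, x) \<in> parcs G \<and> x \<notin> B1} = {w}" "B2 = insert w B1"
    by (auto simp: force_step_def)
  have "w \<in> C"
    by (rule stalled_forces[OF assms(2), of u]) (use uw step.IH in \<open>auto simp: neighbours_def\<close>)
  with uw step.IH show ?case by simp
qed

text \<open>
  A largest set that can be reached by forcing is stalled, since any further force would enlarge it.
\<close>

lemma force_steps_to_stalled:
  assumes "B \<subseteq> pverts G"
  obtains C where "(force_step G)\<^sup>*\<^sup>* B C" "stalled G C" "B \<subseteq> C"
proof -
  define P where "P C \<longleftrightarrow> (force_step G)\<^sup>*\<^sup>* B C \<and> B \<subseteq> C \<and> C \<subseteq> pverts G" for C
  have "finite {C. P C}"
    by (rule finite_subset[of _ "Pow (pverts G)"]) (auto simp: P_def pair_finite_verts)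
  moreover have "B \<in> {C. P C}"
    using assms by (simp add: P_def)
  ultimately obtain C where "C \<in> {C. P C}" "\<forall>D\<in>{C. P C}. C \<subseteq> D \<longrightarrow> C = D"
    by (meson finite_has_maximal2)
  then have C: "P C" and max: "\<And>D. P D \<Longrightarrow> C \<subseteq> D \<Longrightarrow> D = C"
    by auto
  have "stalled G C"
    unfolding stalled_def
  proof (intro conjI ballI allI notI)
    show "C \<subseteq> pverts G" using C by (simp add: P_def)
    fix u w assume u: "u \<in> C" and eq: "neighbours G u - C = {w}"
    have "{x. (u, x) \<in> parcs G \<and> x \<notin> C} = {w}"
      using eq by (auto simp only: neighbours_def set_diff_eq mem_Collect_eq)
    then have "force_step G C (insert w C)"
      unfolding force_step_def using u by blast
    moreover have "w \<in> pverts G" "w \<notin> C"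
      using eq neighbours_subset[of u] by auto
    ultimately have "P (insert w C)"
      using C by (auto simp: P_def)
    then show False
      using max[of "insert w C"] \<open>w \<notin> C\<close> by (metis insertI1 subset_insertI)
  qed
  with C that show thesis by (auto simp: P_def)
qed

text \<open>
  Forcing never leaves a stalled set, and from every set it can be continued until the set is stalled.
\<close>

theorem zero_forcing_set_iff_stalled:
  "zero_forcing_set G B \<longleftrightarrow> B \<subseteq> pverts G \<and> (\<forall>C. stalled G C \<longrightarrow> B \<subseteq> C \<longrightarrow> C = pverts G)"
proof (intro iffI conjI allI impI)
  fix C assume "zero_forcing_set G B" "stalled G C" "B \<subseteq> C"
  then show "C = pverts G"
    using force_steps_within_stalled[of B "pverts G" C]
    by (auto simp: zero_forcing_set_def stalled_def)
next
  assume B: "B \<subseteq> pverts G \<and> (\<forall>C. stalled G C \<longrightarrow> B \<subseteq> C \<longrightarrow> C = pverts G)"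
  then obtain C where "(force_step G)\<^sup>*\<^sup>* B C" "stalled G C" "B \<subseteq> C"
    using force_steps_to_stalled by blast
  with B show "zero_forcing_set G B"
    by (auto simp: zero_forcing_set_def)
qed (simp add: zero_forcing_set_def)

text \<open>
  A nonempty set \<open>F\<close> such that no vertex outside of it has exactly one neighbour in it is called a
  fort. Forts are the complements of the proper stalled sets, and they are the obstructions that
  give lower bounds.
\<close>

lemma zero_forcing_set_meets_fort:
  assumes "zero_forcing_set G B" "F \<subseteq> pverts G" "F \<noteq> {}"
    and fort: "\<And>u w. u \<in> pverts G - F \<Longrightarrow> neighbours G u \<inter> F \<noteq> {w}"
  shows "B \<inter> F \<noteq> {}"
proof
  assume "B \<inter> F = {}"
  have "neighbours G u - (pverts G - F) = neighbours G u \<inter> F" for u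
    using neighbours_subset[of u] by blast
  then have "stalled G (pverts G - F)"
    using fort by (auto simp: stalled_def)
  moreover have "B \<subseteq> pverts G - F"
    using assms(1) \<open>B \<inter> F = {}\<close> by (auto simp: zero_forcing_set_def)
  ultimately have "pverts G - F = pverts G"
    using assms(1) zero_forcing_set_iff_stalled by blast
  then show False using assms(2,3) by blast
qed

lemma finite_zero_forcing_sets: "finite {B. zero_forcing_set G B}"
  by (rule finite_subset[of _ "Pow (pverts G)"]) (auto simp: zero_forcing_set_def pair_finite_verts)

lemma zero_forcing_number_le: "zero_forcing_set G B \<Longrightarrow> zero_forcing_number G \<le> card B"
  unfolding zero_forcing_number_def using finite_zero_forcing_sets by (intro Min_le) auto

lemma zero_forcing_number_attained:
  obtains B where "zero_forcing_set G B" "card B = zero_forcing_number G"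
proof -
  have "Min (card ` {B. zero_forcing_set G B}) \<in> card ` {B. zero_forcing_set G B}"
    using finite_zero_forcing_sets zero_forcing_set_pverts by (intro Min_in) auto
  then show thesis
    using that by (auto simp: zero_forcing_number_def)
qed

lemma finite_independent_sets: "finite {S. independent_set G S}"
  by (rule finite_subset[of _ "Pow (pverts G)"]) (auto simp: independent_set_def pair_finite_verts)

section \<open>Counting the arcs along which no force runs\<close>

text \<open>
  The arcs along which forces run form oriented vertex-disjoint paths. The clause on the neighbours
  of \<open>fst ` A\<close> is what keeps the induction going: a vertex that has forced has only blue neighbours
  and cannot force again.
\<close>

lemma forcing_arcs:
  assumes "(force_step G)\<^sup>*\<^sup>* B B'" "B \<subseteq> pverts G"
  shows "\<exists>A \<subseteq> parcs G. inj_on fst A \<and> inj_on snd A \<and> A \<inter> A\<inverse> = {} \<and> card A + card B = card B'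
    \<and> fst ` A \<subseteq> B' \<and> snd ` A \<subseteq> B' \<and> (\<forall>u\<in>fst ` A. neighbours G u \<subseteq> B') \<and> B' \<subseteq> pverts G"
  using assms(1)
proof (induction rule: rtranclp_induct)
  case base
  show ?case using assms(2) by (intro exI[of _ "{}"]) auto
next
  case (step B1 B2)
  from step.hyps(2) obtain u w where uw: "u \<in> B1" "neighbours G u - B1 = {w}" "B2 = insert w B1"
    by (auto simp: force_step_def neighbours_def set_diff_eq)
  from step.IH obtain A where A: "A \<subseteq> parcs G" "inj_on fst A" "inj_on snd A" "A \<inter> A\<inverse> = {}"
    "card A + card B = card B1" "fst ` A \<subseteq> B1" "snd ` A \<subseteq> B1"
    "\<forall>u\<in>fst ` A. neighbours G u \<subseteq> B1" "B1 \<subseteq> pverts G"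
    by blast
  have fin: "finite A" "finite B1"
    using A(1,9) pair_finite_arcs pair_finite_verts by (auto intro: finite_subset)
  have w: "w \<notin> B1" "w \<in> neighbours G u" using uw by auto
  have u: "u \<notin> fst ` A" using w A(8) by blast
  have "w \<noteq> u" using w uw by auto
  have "w \<notin> fst ` A" "w \<notin> snd ` A" using w A by auto
  show ?case
  proof (intro exI[of _ "insert (u, w) A"] conjI)
    show "insert (u, w) A \<subseteq> parcs G" using A w by (auto simp: neighbours_def)
    show "inj_on fst (insert (u, w) A)" "inj_on snd (insert (u, w) A)"
      using A u \<open>w \<notin> snd ` A\<close> by auto
    show "insert (u, w) A \<inter> (insert (u, w) A)\<inverse> = {}"
      using A(4) \<open>w \<noteq> u\<close> \<open>w \<notin> fst ` A\<close> by force
    show "card (insert (u, w) A) + card B = card B2"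
      using fin A(5) w uw(3) u by (subst card_insert_disjoint) force+
    show "fst ` insert (u, w) A \<subseteq> B2" "snd ` insert (u, w) A \<subseteq> B2" using A uw by auto
    show "\<forall>u\<in>fst ` insert (u, w) A. neighbours G u \<subseteq> B2" using A(8) uw by auto
    show "B2 \<subseteq> pverts G" using A(9) uw w neighbours_subset by auto
  qed
qed

text \<open>
  Of the at least three arcs at \<open>s \<in> S\<close> at most two belong to a force, one leaving \<open>s\<close> and one
  entering it. So each \<open>s\<close> has an arc that is unused in either direction, and since \<open>S\<close> is
  independent, different \<open>s\<close> have different unused edges. For a tree, the bound reads
  \<open>card S + 1 \<le> card B\<close>.
\<close>

theorem independent_degree_three_bound:
  assumes "zero_forcing_set G B" "independent_set G S" "\<And>s. s \<in> S \<Longrightarrow> 3 \<le> card (neighbours G s)"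
  shows "2 * card S + 2 * card (pverts G) \<le> card (parcs G) + 2 * card B"
proof -
  have B: "B \<subseteq> pverts G" "(force_step G)\<^sup>*\<^sup>* B (pverts G)"
    using assms(1) by (auto simp: zero_forcing_set_def)
  from forcing_arcs[OF B(2,1)] obtain A where A: "A \<subseteq> parcs G" "inj_on fst A" "inj_on snd A"
    "A \<inter> A\<inverse> = {}" "card A + card B = card (pverts G)"
    by blast
  have finA: "finite A" using A(1) pair_finite_arcs by (auto intro: finite_subset)
  define U where "U = parcs G - (A \<union> A\<inverse>)"
  have sub: "A \<union> A\<inverse> \<subseteq> parcs G" using A(1) arcs_symmetric by auto
  have cardU: "card U + 2 * card A = card (parcs G)"
  proof -
    have "card (A \<union> A\<inverse>) = 2 * card A"
      using A(4) finA by (simp add: card_Un_disjoint)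
    then show ?thesis
      using card_Diff_subset[of "A \<union> A\<inverse>" "parcs G"] card_mono[OF pair_finite_arcs sub] sub finA
      by (simp add: U_def)
  qed
  have "\<exists>t. (s, t) \<in> U" if "s \<in> S" for s
  proof (rule ccontr)
    assume "\<nexists>t. (s, t) \<in> U"
    then have "neighbours G s \<subseteq> A `` {s} \<union> A\<inverse> `` {s}"
      by (auto simp: U_def neighbours_def)
    moreover have "finite (A `` {s})" "finite (A\<inverse> `` {s})"
      using finA by (auto intro: finite_Image)
    ultimately have "card (neighbours G s) \<le> card (A `` {s}) + card (A\<inverse> `` {s})"
      using card_mono[of "A `` {s} \<union> A\<inverse> `` {s}" "neighbours G s"] card_Un_le[of "A `` {s}" "A\<inverse> `` {s}"]
      by simp
    moreover have "card (A `` {s}) \<le> Suc 0"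
      using A(2) \<open>finite (A `` {s})\<close> by (force simp: card_le_Suc0_iff_eq inj_on_def)
    moreover have "card (A\<inverse> `` {s}) \<le> Suc 0"
      using A(3) \<open>finite (A\<inverse> `` {s})\<close> by (force simp: card_le_Suc0_iff_eq inj_on_def)
    ultimately show False using assms(3)[OF that] by linarith
  qed
  then obtain f where f: "\<And>s. s \<in> S \<Longrightarrow> (s, f s) \<in> U" by metis
  have out: "f s \<notin> S" if "s \<in> S" for s
    using f[OF that] assms(2) that by (auto simp: U_def independent_set_def)
  have U_sym: "(t, s) \<in> U" if "(s, t) \<in> U" for s t
    using that arcs_symmetric by (auto simp: U_def)
  have finS: "finite S" using assms(2) pair_finite_verts by (auto simp: independent_set_def intro: finite_subset)
  \<comment> \<open>Both orientations are counted, since \<open>U\<close> is a set of arcs.\<close>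
  have "card ((\<lambda>s. (s, f s)) ` S \<union> (\<lambda>s. (f s, s)) ` S) = card S + card S"
    using finS out by (subst card_Un_disjoint) (auto simp: card_image inj_on_def)
  moreover have "(\<lambda>s. (s, f s)) ` S \<union> (\<lambda>s. (f s, s)) ` S \<subseteq> U"
    using f U_sym by auto
  moreover have "finite U" using pair_finite_arcs by (simp add: U_def)
  ultimately have "2 * card S \<le> card U"
    using card_mono[of U "(\<lambda>s. (s, f s)) ` S \<union> (\<lambda>s. (f s, s)) ` S"] by simp
  then show ?thesis using cardU A(5) by linarith
qed

end

section \<open>Branches of a rooted tree\<close>

text \<open>
  In \<open>branch G p v W\<close>, the set \<open>W\<close> consists of \<open>v\<close> and all its descendants when \<open>p\<close> is
  the parent of \<open>v\<close>. The explicit disjointness conditions carry all that is needed of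
  acyclicity, and induction over this predicate is induction over a binary tree.
\<close>

inductive branch :: "'a pair_pre_digraph \<Rightarrow> 'a \<Rightarrow> 'a \<Rightarrow> 'a set \<Rightarrow> bool"
  for G :: "'a pair_pre_digraph" where
  end_leaf: "neighbours G v = {p} \<Longrightarrow> branch G p v {v}"
| fork: "\<lbrakk>neighbours G v = {p, x, y}; p \<noteq> x; p \<noteq> y; x \<noteq> y; branch G v x X; branch G v y Y;
    p \<notin> X \<union> Y; v \<notin> X \<union> Y; X \<inter> Y = {}\<rbrakk> \<Longrightarrow> branch G p v (insert v (X \<union> Y))"

lemma branch_root: "branch G p v W \<Longrightarrow> v \<in> W"
  by (induction rule: branch.induct) auto

lemma branch_parent: "branch G p v W \<Longrightarrow> p \<in> neighbours G v"
  by (induction rule: branch.induct) auto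

lemma branch_finite: "branch G p v W \<Longrightarrow> finite W"
  by (induction rule: branch.induct) auto

lemma branch_neighbours: "branch G p v W \<Longrightarrow> w \<in> W \<Longrightarrow> neighbours G w \<subseteq> insert p W"
  by (induction arbitrary: w rule: branch.induct) (use branch_root in fastforce)+

lemma branch_has_leaf: "branch G p v W \<Longrightarrow> \<exists>l q. neighbours G l = {q}"
  by (induction rule: branch.induct) auto

text \<open>
  All edges that meet \<open>W\<close> lie inside of it, where a tree on \<open>W\<close> has \<open>card W - 1\<close> edges, except for the
  one from the root to the parent.
\<close>

lemma branch_degree_sum:
  "branch G p v W \<Longrightarrow> (\<Sum>w\<in>W. card (neighbours G w)) + 1 = 2 * card W"
proof (induction rule: branch.induct)
  case (fork v p x y X Y)
  have fin: "finite X" "finite Y" using fork branch_finite by auto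
  have "card (neighbours G v) = 3" using fork by simp
  then show ?case using fork fin by (simp add: sum.union_disjoint card_Un_disjoint)
qed simp

lemma (in pair_graph) branch_subset: "branch G p v W \<Longrightarrow> W \<subseteq> pverts G"
proof (induction rule: branch.induct)
  case (end_leaf v p)
  then show ?case using neighbours_sym[of p v] neighbours_subset[of p] by auto
next
  case (fork v p x y X Y)
  then show ?case using neighbours_sym[of p v] neighbours_subset[of p] by auto
qed

text \<open>
  The two ways in which a branch can be covered by forcing paths, expressed by stalled sets.

  In a self-starting branch the initial vertices \<open>B\<close> make the root \<open>v\<close> blue without help from
  outside. The root may then have both its parent and a child white, so the rest of the branch is
  only guaranteed to follow once the parent is blue. No path uses the edge to the parent.
\<close>

definition self_starting :: "'a pair_pre_digraph \<Rightarrow> 'a \<Rightarrow> 'a \<Rightarrow> 'a set \<Rightarrow> 'a set \<Rightarrow> bool" where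
  "self_starting G p v W B \<longleftrightarrow>
     (\<forall>C. stalled G C \<longrightarrow> B \<subseteq> C \<longrightarrow> v \<in> C \<and> (p \<in> C \<longrightarrow> W \<subseteq> C))"

text \<open>
  In a startable branch one path has to be fed from outside. It can be run in both directions:
  upwards, by making its lower end \<open>b\<close> blue initially, or downwards, when \<open>v\<close> has become blue. In
  the second case \<open>p\<close> must be blue as well, for otherwise \<open>v\<close> could not force one of its children.
\<close>

definition startable :: "'a pair_pre_digraph \<Rightarrow> 'a \<Rightarrow> 'a \<Rightarrow> 'a set \<Rightarrow> 'a set \<Rightarrow> 'a \<Rightarrow> bool" where
  "startable G p v W B b \<longleftrightarrow>
     (\<forall>C. stalled G C \<longrightarrow> B \<subseteq> C \<longrightarrow> b \<in> C \<or> (v \<in> C \<and> p \<in> C) \<longrightarrow> W \<subseteq> C)"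

context pair_graph
begin


lemma branch_pushes_up:
  assumes "branch G v x X" "stalled G C" "X \<subseteq> C"
  shows "v \<in> C"
proof (rule stalled_forces[OF assms(2)])
  show "x \<in> C" using branch_root[OF assms(1)] assms(3) by blast
  show "v \<in> neighbours G x" by (rule branch_parent[OF assms(1)])
  show "neighbours G x - {v} \<subseteq> C"
    using branch_neighbours[OF assms(1) branch_root[OF assms(1)]] assms(3) by blast
qed

text \<open>
  The path of the first branch is started at \<open>b1\<close>, comes up to \<open>v\<close> and goes down into the second
  branch. This last turn has to wait until the parent of \<open>v\<close> is blue. The initial vertex \<open>b1\<close> is
  paid for by \<open>v\<close>, which joins the independent set.
\<close>

lemma fork_of_startables:
  assumes nb: "neighbours G v = {p, x, y}"
    and br: "branch G v x X" "branch G v y Y"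
    and X: "startable G v x X B1 b1" and Y: "startable G v y Y B2 b2"
  shows "self_starting G p v (insert v (X \<union> Y)) (insert b1 (B1 \<union> B2))"
  unfolding self_starting_def
proof (intro allI impI)
  fix C assume C: "stalled G C" "insert b1 (B1 \<union> B2) \<subseteq> C"
  then have "X \<subseteq> C" using X by (auto simp: startable_def)
  then have v: "v \<in> C" using branch_pushes_up br(1) C(1) by blast
  have "insert v (X \<union> Y) \<subseteq> C" if "p \<in> C"
  proof -
    \<comment> \<open>The last turn: all neighbours of \<open>v\<close> except \<open>y\<close> are blue now.\<close>
    have "y \<in> C"
      using C(1) v by (rule stalled_forces) (use nb that \<open>X \<subseteq> C\<close> branch_root[OF br(1)] in auto)
    then have "Y \<subseteq> C" using C v Y by (auto simp: startable_def)
    then show ?thesis using v \<open>X \<subseteq> C\<close> by simp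
  qed
  with v show "v \<in> C \<and> (p \<in> C \<longrightarrow> insert v (X \<union> Y) \<subseteq> C)" by blast
qed

text \<open>
  The root \<open>x\<close> of the self-starting branch is blue in any case, so the path of the other branch
  passes through \<open>v\<close> undisturbed in either direction. After that \<open>v\<close> is blue, which completes the
  first branch.
\<close>

lemma fork_of_self_starting_and_startable:
  assumes nb: "neighbours G v = {p, x, y}"
    and br: "branch G v x X" "branch G v y Y"
    and X: "self_starting G v x X B1" and Y: "startable G v y Y B2 b"
  shows "startable G p v (insert v (X \<union> Y)) (B1 \<union> B2) b"
  unfolding startable_def
proof (intro allI impI)
  fix C assume C: "stalled G C" "B1 \<union> B2 \<subseteq> C" and start: "b \<in> C \<or> v \<in> C \<and> p \<in> C"
  have x: "x \<in> C" using C X by (auto simp: self_starting_def)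
  have "v \<in> C \<and> Y \<subseteq> C"
    using start
  proof
    assume "b \<in> C"
    then have "Y \<subseteq> C" using C Y by (auto simp: startable_def)
    then show ?thesis using branch_pushes_up br(2) C(1) by blast
  next
    assume vp: "v \<in> C \<and> p \<in> C"
    have "y \<in> C"
      using C(1) by (rule stalled_forces[of G C v]) (use nb vp x in auto)
    then show ?thesis using C vp Y by (auto simp: startable_def)
  qed
  moreover from this have "X \<subseteq> C" using C X by (auto simp: self_starting_def)
  ultimately show "insert v (X \<union> Y) \<subseteq> C" by simp
qed

text \<open>
  Both branches wait for nothing but \<open>v\<close>, which is the lower end of its own path.
\<close>

lemma fork_of_self_startings:
  assumes "self_starting G v x X B1" "self_starting G v y Y B2"
  shows "startable G p v (insert v (X \<union> Y)) (B1 \<union> B2) v"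
  using assms by (auto simp: startable_def self_starting_def)

definition internal_independent :: "'a set \<Rightarrow> bool" where
  "internal_independent S \<longleftrightarrow> independent_set G S \<and> (\<forall>s\<in>S. card (neighbours G s) = 3)"

lemma internal_independent_union:
  assumes "internal_independent I" "internal_independent J" "I \<subseteq> X" "J \<subseteq> Y"
    and "branch G v x X" "branch G v y Y" "X \<inter> Y = {}" "v \<notin> X \<union> Y"
  shows "internal_independent (I \<union> J)"
proof -
  have "(i, j) \<notin> parcs G \<and> (j, i) \<notin> parcs G" if "i \<in> I" "j \<in> J" for i j
  proof -
    have "i \<in> X" "j \<in> Y" using that assms(3,4) by auto
    have "neighbours G i \<subseteq> insert v X" "neighbours G j \<subseteq> insert v Y"
      by (rule branch_neighbours[OF assms(5) \<open>i \<in> X\<close>], rule branch_neighbours[OF assms(6) \<open>j \<in> Y\<close>])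
    then show ?thesis using \<open>i \<in> X\<close> \<open>j \<in> Y\<close> assms(7,8) by (auto simp: neighbours_def)
  qed
  then have "(i, j) \<notin> parcs G" if "i \<in> I \<union> J" "j \<in> I \<union> J" for i j
    using that assms(1,2) unfolding internal_independent_def independent_set_def by blast
  then show ?thesis
    using assms(1,2) unfolding internal_independent_def independent_set_def by blast
qed

lemma internal_independent_insert:
  assumes "internal_independent I" "card (neighbours G v) = 3" "neighbours G v \<inter> I = {}"
  shows "internal_independent (insert v I)"
proof -
  have "v \<in> pverts G"
  proof -
    obtain w where "w \<in> neighbours G v"
      using assms(2) by (metis card.empty ex_in_conv zero_neq_numeral)
    then show ?thesis by (auto simp: neighbours_def dest: in_arcsD1)
  qed
  moreover have "(v, v) \<notin> parcs G" using no_loops' by blast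
  moreover have "(v, i) \<notin> parcs G \<and> (i, v) \<notin> parcs G" if "i \<in> I" for i
    using assms(3) that arcs_symmetric[of i v] by (auto simp: neighbours_def)
  ultimately show ?thesis
    using assms(1,2) unfolding internal_independent_def independent_set_def by blast
qed

text \<open>
  The greedy choice: when both branches below it are startable with roots outside of \<open>I\<close>, the root
  of a fork joins \<open>I\<close>, and the fork is self-starting; in the remaining cases the root stays outside
  of \<open>I\<close>, and the fork is startable. Each vertex of \<open>I\<close> pays for one initial vertex.
\<close>

lemma branch_forcing:
  assumes "branch G p v W"
  shows "\<exists>I B. I \<subseteq> W \<and> B \<subseteq> W \<and> internal_independent I \<and> card B \<le> card I
    \<and> (self_starting G p v W B \<or> v \<notin> I \<and> (\<exists>b\<in>W. startable G p v W B b))"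
  using assms
proof (induction rule: branch.induct)
  case (end_leaf v p)
  show ?case
    by (rule exI[of _ "{}"], rule exI[of _ "{}"])
      (auto simp: startable_def internal_independent_def independent_set_def)
next
  case (fork v p x y X Y)
  from fork.IH(1) obtain I B where X: "I \<subseteq> X" "B \<subseteq> X" "internal_independent I" "card B \<le> card I"
    "self_starting G v x X B \<or> x \<notin> I \<and> (\<exists>b\<in>X. startable G v x X B b)"
    by blast
  from fork.IH(2) obtain J D where Y: "J \<subseteq> Y" "D \<subseteq> Y" "internal_independent J" "card D \<le> card J"
    "self_starting G v y Y D \<or> y \<notin> J \<and> (\<exists>b\<in>Y. startable G v y Y D b)"
    by blast
  have fin: "finite X" "finite Y" using fork.hyps(5,6) by (auto intro: branch_finite)
  then have finIJ: "finite I" "finite J" using X Y finite_subset by auto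
  have sub: "I \<union> J \<subseteq> insert v (X \<union> Y)" "B \<union> D \<subseteq> insert v (X \<union> Y)" using X Y by auto
  have IJ: "internal_independent (I \<union> J)"
    using internal_independent_union[OF X(3) Y(3) X(1) Y(1)] fork.hyps by blast
  have cIJ: "card (I \<union> J) = card I + card J"
    using X Y fork.hyps(9) finIJ by (intro card_Un_disjoint) auto
  have cBD: "card (B \<union> D) \<le> card (I \<union> J)"
    using card_Un_le[of B D] X(4) Y(4) cIJ by linarith
  have swap: "insert v (X \<union> Y) = insert v (Y \<union> X)" "B \<union> D = D \<union> B" "{p, x, y} = {p, y, x}" by auto
  have vIJ: "v \<notin> I \<union> J" using X Y fork.hyps(8) by blast
  consider (ss) "self_starting G v x X B" "self_starting G v y Y D"
    | (sn) b where "self_starting G v x X B" "b \<in> Y" "startable G v y Y D b"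
    | (ns) b where "self_starting G v y Y D" "b \<in> X" "startable G v x X B b"
    | (nn) b b' where "x \<notin> I" "b \<in> X" "startable G v x X B b" "y \<notin> J" "startable G v y Y D b'"
    using X(5) Y(5) by blast
  then show ?case
  proof cases
    case ss
    then have "startable G p v (insert v (X \<union> Y)) (B \<union> D) v" by (rule fork_of_self_startings)
    then show ?thesis
      using sub IJ cBD vIJ by (intro exI[of _ "I \<union> J"] exI[of _ "B \<union> D"]) auto
  next
    case sn
    then have "startable G p v (insert v (X \<union> Y)) (B \<union> D) b"
      by (intro fork_of_self_starting_and_startable[OF fork.hyps(1,5,6)] sn)
    then show ?thesis
      using sub IJ cBD vIJ sn(2) by (intro exI[of _ "I \<union> J"] exI[of _ "B \<union> D"]) auto
  next
    case ns
    have "startable G p v (insert v (X \<union> Y)) (B \<union> D) b"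
      unfolding swap(1,2)
      by (rule fork_of_self_starting_and_startable[OF fork.hyps(1)[unfolded swap(3)] fork.hyps(6,5) ns(1,3)])
    then show ?thesis
      using sub IJ cBD vIJ ns(2) by (intro exI[of _ "I \<union> J"] exI[of _ "B \<union> D"]) auto
  next
    case nn
    have "self_starting G p v (insert v (X \<union> Y)) (insert b (B \<union> D))"
      by (rule fork_of_startables[OF fork.hyps(1,5,6) nn(3,5)])
    moreover have "internal_independent (insert v (I \<union> J))"
    proof (rule internal_independent_insert[OF IJ])
      show "card (neighbours G v) = 3" using fork.hyps(1-4) by simp
      show "neighbours G v \<inter> (I \<union> J) = {}"
        using fork.hyps(1,7,9) nn(1,4) X(1) Y(1) branch_root[OF fork.hyps(5)] branch_root[OF fork.hyps(6)]
        by auto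
    qed
    moreover have "card (insert b (B \<union> D)) \<le> card (insert v (I \<union> J))"
    proof -
      have "finite (B \<union> D)" using X(2) Y(2) fin finite_subset by blast
      then have "card (insert b (B \<union> D)) \<le> card (B \<union> D) + 1" by (simp add: card_insert_if)
      also have "\<dots> \<le> card (insert v (I \<union> J))" using cBD vIJ finIJ by simp
      finally show ?thesis .
    qed
    moreover have "insert b (B \<union> D) \<subseteq> insert v (X \<union> Y)" "insert v (I \<union> J) \<subseteq> insert v (X \<union> Y)"
      using sub nn(2) by simp_all
    ultimately show ?thesis
      by (intro exI[of _ "insert v (I \<union> J)"] exI[of _ "insert b (B \<union> D)"] conjI disjI1)
  qed
qed

text \<open>
  The root leaf \<open>r\<close> is the additional initial vertex. It forces \<open>c\<close>, so the branch has both its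
  root and its parent blue, and this completes either kind of branch.
\<close>

theorem rooted_tree_zero_forcing:
  assumes r: "neighbours G r = {c}" and br: "branch G r c W" and V: "pverts G = insert r W"
  shows "\<exists>I B. internal_independent I \<and> zero_forcing_set G B \<and> card B \<le> card I + 1"
proof -
  from branch_forcing[OF br] obtain I B
    where IB: "I \<subseteq> W" "B \<subseteq> W" "internal_independent I" "card B \<le> card I"
    and "self_starting G r c W B \<or> c \<notin> I \<and> (\<exists>b\<in>W. startable G r c W B b)"
    by blast
  then have forcing: "self_starting G r c W B \<or> (\<exists>b. startable G r c W B b)" by metis
  have "zero_forcing_set G (insert r B)"
    unfolding zero_forcing_set_iff_stalled
  proof (intro conjI allI impI)
    show "insert r B \<subseteq> pverts G" using IB(2) V by auto
    fix C assume C: "stalled G C" "insert r B \<subseteq> C"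
    have "c \<in> C" by (rule stalled_forces[of G C r]) (use r C in auto)
    moreover have "r \<in> C" "B \<subseteq> C" using C(2) by auto
    ultimately have "W \<subseteq> C"
      using forcing C(1) unfolding self_starting_def startable_def by (elim disjE exE) iprover+
    moreover have "C \<subseteq> pverts G" using C(1) by (simp add: stalled_def)
    ultimately show "C = pverts G" using C(2) V by blast
  qed
  moreover have "card (insert r B) \<le> card I + 1"
    using IB(4) finite_subset[OF IB(2) branch_finite[OF br]] by (auto simp: card_insert_if)
  ultimately show ?thesis using IB(3) by (intro exI[of _ I] exI[of _ "insert r B"] conjI)
qed

end

section \<open>Rooting a tree whose degrees are one and three\<close>

definition avoiding :: "'a pair_pre_digraph \<Rightarrow> 'a \<Rightarrow> 'a rel" where
  "avoiding G v = (parcs G \<inter> (- {v}) \<times> (- {v}))\<^sup>*"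

context pair_graph
begin

lemma avoiding_sym: "(a, b) \<in> avoiding G v \<Longrightarrow> (b, a) \<in> avoiding G v"
proof -
  have "sym (parcs G \<inter> (- {v}) \<times> (- {v}))"
    by (auto intro!: symI dest: arcs_symmetric)
  then show "(a, b) \<in> avoiding G v \<Longrightarrow> (b, a) \<in> avoiding G v"
    unfolding avoiding_def by (meson sym_rtrancl symD)
qed

lemma avoiding_apath:
  assumes "(x, y) \<in> avoiding G v" "x \<noteq> v" "y \<in> pverts G" "y \<noteq> v"
  obtains p where "apath x p y" "v \<notin> set (pawalk_verts x p)"
proof -
  have "\<exists>p. awalk x p y \<and> v \<notin> set (pawalk_verts x p)"
    using assms(1) unfolding avoiding_def
  proof (induction rule: converse_rtrancl_induct)
    case base
    show ?case using assms(3,4) by (intro exI[of _ "[]"]) (auto simp: awalk_Nil_iff)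
  next
    case (step a b)
    then obtain p where "awalk b p y" "v \<notin> set (pawalk_verts b p)" by blast
    then show ?case using step.hyps(1) by (intro exI[of _ "(a, b) # p"]) (auto simp: awalk_Cons_iff)
  qed
  then obtain p where p: "awalk x p y" "v \<notin> set (pawalk_verts x p)" by blast
  have q: "apath x (awalk_to_apath p) y" by (rule apath_awalk_to_apath[OF p(1)])
  have "set (pawalk_verts x (awalk_to_apath p)) \<subseteq> set (pawalk_verts x p)"
    using awalk_to_apath_subset[OF p(1)] set_awalk_verts[OF p(1)] set_awalk_verts[OF awalkI_apath[OF q]]
    by auto
  with p(2) q that show thesis by blast
qed

text \<open>
  A path from \<open>x\<close> to \<open>y\<close> that avoids \<open>v\<close> would close up through \<open>v\<close> to a cycle. Since
  \<open>x \<noteq> y\<close>, the path has an arc, so this cycle has length at least 3.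
\<close>

lemma acyclic_separates:
  assumes acyc: "\<not> (\<exists>p. pre_digraph.cycle (with_proj G) p \<and> 3 \<le> length p)"
    and x: "x \<in> neighbours G v" and y: "y \<in> neighbours G v" and "x \<noteq> y"
  shows "(x, y) \<notin> avoiding G v"
proof
  assume "(x, y) \<in> avoiding G v"
  moreover have "x \<noteq> v" "y \<noteq> v" "y \<in> pverts G"
    using x y neighbours_irrefl neighbours_subset by auto
  ultimately obtain p where p: "apath x p y" "v \<notin> set (pawalk_verts x p)"
    using avoiding_apath by metis
  \<comment> \<open>The closed walk from \<open>v\<close> to \<open>x\<close>, along \<open>p\<close> to \<open>y\<close> and back to \<open>v\<close>.\<close>
  let ?p = "(v, x) # p @ [(y, v)]"
  have arcs: "(v, x) \<in> parcs G" "(y, v) \<in> parcs G"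
    using x y arcs_symmetric by (auto simp: neighbours_def)
  have w: "awalk x p y" "distinct (pawalk_verts x p)" using p(1) by (auto simp: apath_def)
  have last: "last (pawalk_verts x p) = y" using awlast_of_awalk[OF w(1)] w(1) by auto
  have xpy: "awalk x (p @ [(y, v)]) v"
    using w(1) by (rule awalk_appendI) (use arcs in_arcsD2 in \<open>auto simp: awalk_simps\<close>)
  then have cyc: "awalk v ?p v" using arcs by (auto simp: awalk_Cons_iff)
  have "pawalk_verts x (p @ [(y, v)]) = pawalk_verts x p @ [v]"
    using awalk_verts_append[OF xpy] last by simp
  then have "distinct (tl (pawalk_verts v ?p))" using w(2) p(2) by simp
  with cyc have "cycle ?p" by (auto simp: cycle_def)
  moreover have "p \<noteq> []" using w(1) \<open>x \<noteq> y\<close> by (auto simp: awalk_Nil_iff)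
  then have "3 \<le> length ?p" by (cases p) auto
  ultimately show False using acyc by blast
qed

lemma connected_path:
  assumes "connected (with_proj G)" "u \<in> pverts G" "w \<in> pverts G"
  shows "(u, w) \<in> (parcs G)\<^sup>*"
proof -
  have "reachable (with_proj (mk_symmetric (with_proj G))) u w"
    using assms by (auto simp: connected_def strongly_connected_def)
  then have "reachable (with_proj G) u w"
    using reachable_mk_symmetric_eq[OF pair_sym_arcs] by simp
  then show ?thesis
    by (auto simp: reachable_def dest: rtrancl_on_rtranclI)
qed

end

locale three_one =
  fixes T :: "'a pair_pre_digraph"
  assumes three_one: "three_one_tree T"

sublocale three_one \<subseteq> pair_graph T
  using three_one by (simp add: three_one_tree_def undirected_tree_def)

context three_one
begin

lemma acyclic: "\<not> (\<exists>p. pre_digraph.cycle (with_proj T) p \<and> 3 \<le> length p)"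
  and connected: "connected (with_proj T)"
  using three_one by (auto simp: three_one_tree_def undirected_tree_def)

lemma degree: "v \<in> pverts T \<Longrightarrow> card (neighbours T v) = 1 \<or> card (neighbours T v) = 3"
  using three_one by (simp add: three_one_tree_def out_degree_eq_card_neighbours)

text \<open>
  The descendants of \<open>v\<close> below \<open>p\<close> are the vertices that \<open>v\<close> reaches while avoiding \<open>p\<close>. Removing
  \<open>v\<close> as well separates its three neighbours, which yields the disjointness conditions of a fork
  and makes the set smaller.
\<close>

lemma branch_avoiding:
  "p \<in> neighbours T v \<Longrightarrow> branch T p v (avoiding T p `` {v})"
proof (induction "card (avoiding T p `` {v})" arbitrary: p v rule: less_induct)
  case less
  have v: "v \<in> pverts T" "p \<noteq> v"
    using less.prems neighbours_sym neighbours_subset neighbours_irrefl by blast+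
  have side_step: "b \<in> avoiding T q `` {a}" if "c \<in> avoiding T q `` {a}" "c \<noteq> q" "b \<in> neighbours T c" "b \<noteq> q"
    for a b c q
    using that by (auto simp: avoiding_def neighbours_def intro: rtrancl_into_rtrancl)
  have side_root: "a \<in> avoiding T q `` {a}" for a q by (simp add: avoiding_def)
  have side_avoids: "q \<notin> avoiding T q `` {a}" if "a \<noteq> q" for a q
    using that by (auto simp: avoiding_def elim: rtranclE)
  show ?case
  proof (cases "card (neighbours T v) = 1")
    case True
    then have nb: "neighbours T v = {p}"
      using less.prems by (auto simp: card_1_singleton_iff)
    have "w = v" if "(v, w) \<in> avoiding T p" for w
      using that unfolding avoiding_def
    proof (induction rule: rtrancl_induct)
      case (step a b)
      then show ?case using nb by (auto simp: neighbours_def)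
    qed simp
    then have "avoiding T p `` {v} = {v}" using side_root by auto
    then show ?thesis using branch.end_leaf[OF nb] by simp
  next
    case False
    then have "card (neighbours T v) = 3" using degree v(1) by blast
    then have "card (neighbours T v - {p}) = 2" using less.prems by simp
    then obtain x y where xy: "neighbours T v - {p} = {x, y}" "x \<noteq> y"
      by (auto simp: card_2_iff)
    then have nb: "neighbours T v = {p, x, y}" and ne: "p \<noteq> x" "p \<noteq> y"
      using less.prems by auto
    have vne: "x \<noteq> v" "y \<noteq> v" using nb neighbours_irrefl[of v] by auto
    let ?X = "avoiding T v `` {x}" and ?Y = "avoiding T v `` {y}" and ?W = "avoiding T p `` {v}"
    have sep: "(a, b) \<notin> avoiding T v" if "a \<in> {p, x, y}" "b \<in> {p, x, y}" "a \<noteq> b" for a b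
      using acyclic_separates[OF acyclic] that nb by blast
    have pXY: "p \<notin> ?X \<union> ?Y" using sep ne by auto
    have vXY: "v \<notin> ?X \<union> ?Y" using side_avoids vne by blast
    have disj: "?X \<inter> ?Y = {}"
    proof (rule ccontr)
      assume "?X \<inter> ?Y \<noteq> {}"
      then obtain z where "(x, z) \<in> avoiding T v" "(y, z) \<in> avoiding T v" by auto
      then have "(x, y) \<in> avoiding T v"
        using avoiding_sym[of y z v] unfolding avoiding_def by (blast intro: rtrancl_trans)
      then show False using sep xy(2) by auto
    qed
    have sub: "avoiding T v `` {z} \<subseteq> ?W" if z: "z \<in> {x, y}" for z
    proof
      fix w assume "w \<in> avoiding T v `` {z}"
      then have "(z, w) \<in> (parcs T \<inter> (- {v}) \<times> (- {v}))\<^sup>*" by (simp add: avoiding_def)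
      then show "w \<in> ?W"
      proof (induction rule: rtrancl_induct)
        case base
        show ?case by (rule side_step[of v]) (use z ne nb v side_root in auto)
      next
        case (step a b)
        then have "b \<in> avoiding T v `` {z}"
          by (auto simp: avoiding_def intro: rtrancl_into_rtrancl)
        then have "b \<noteq> p" using z pXY by auto
        moreover have "a \<noteq> p" using step(1) z pXY by (auto simp: avoiding_def)
        ultimately show ?case
          using side_step[of a p v b] step by (auto simp: neighbours_def)
      qed
    qed
    have W: "?W = insert v (?X \<union> ?Y)"
    proof
      show "insert v (?X \<union> ?Y) \<subseteq> ?W" using sub side_root by auto
      show "?W \<subseteq> insert v (?X \<union> ?Y)"
      proof
        fix w assume "w \<in> ?W"
        then have "(v, w) \<in> (parcs T \<inter> (- {p}) \<times> (- {p}))\<^sup>*" by (simp add: avoiding_def)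
        then show "w \<in> insert v (?X \<union> ?Y)"
        proof (induction rule: rtrancl_induct)
          case (step a b)
          then have b: "b \<in> neighbours T a" "b \<noteq> p" by (auto simp: neighbours_def)
          show ?case
          proof (cases "a = v \<or> b = v")
            case True
            then show ?thesis using b nb side_root by auto
          next
            case False
            then show ?thesis
              using step.IH side_step[of a v x b, OF _ _ b(1)] side_step[of a v y b, OF _ _ b(1)] by auto
          qed
        qed simp
      qed
    qed
    have fin: "finite ?W"
    proof (rule finite_subset[OF _ pair_finite_verts], rule subsetI)
      fix w assume "w \<in> ?W"
      then have "(v, w) \<in> (parcs T \<inter> (- {p}) \<times> (- {p}))\<^sup>*" by (simp add: avoiding_def)
      then show "w \<in> pverts T"
        using v(1) by (induction rule: rtrancl_induct) (auto dest: in_arcsD2)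
    qed
    have less': "card (avoiding T v `` {z}) < card ?W" if "z \<in> {x, y}" for z
      using that fin vXY W by (intro psubset_card_mono) auto
    have "branch T v x ?X" "branch T v y ?Y"
      by (rule less.hyps[OF less']; use nb neighbours_sym[of v] in auto)+
    then show ?thesis
      unfolding W using nb ne xy(2) pXY vXY disj branch.fork[of T v p x y ?X ?Y] by blast
  qed
qed

lemma rooted_at_leaf:
  obtains r c W where "neighbours T r = {c}" "branch T r c W" "pverts T = insert r W" "r \<notin> W"
proof -
  obtain v where "v \<in> pverts T"
    using connected by (auto simp: connected_def strongly_connected_def)
  then obtain p where "p \<in> neighbours T v" using degree[of v] by fastforce
  from branch_has_leaf[OF branch_avoiding[OF this]] obtain r c where r: "neighbours T r = {c}" by blast
  then have c: "r \<in> neighbours T c" using neighbours_sym by auto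
  then have rV: "r \<in> pverts T" "r \<noteq> c" using neighbours_subset neighbours_irrefl by auto
  have br: "branch T r c (avoiding T r `` {c})" by (rule branch_avoiding[OF c])
  have "w \<in> insert r (avoiding T r `` {c})" if "w \<in> pverts T" for w
    using connected_path[OF connected rV(1) that]
  proof (induction rule: rtrancl_induct)
    case (step a b)
    show ?case
    proof (cases "a = r \<or> b = r")
      case True
      then show ?thesis using step.hyps(2) r by (auto simp: neighbours_def avoiding_def)
    next
      case False
      then show ?thesis using step by (auto simp: avoiding_def intro: rtrancl_into_rtrancl)
    qed
  qed simp
  then have "pverts T = insert r (avoiding T r `` {c})"
    using branch_subset[OF br] rV(1) by auto
  moreover have "r \<notin> avoiding T r `` {c}"
    using rV(2) by (auto simp: avoiding_def elim: rtranclE)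
  ultimately show thesis using r br that by blast
qed

lemma card_arcs: "card (parcs T) + 2 = 2 * card (pverts T)"
proof -
  obtain r c W where r: "neighbours T r = {c}" "branch T r c W" "pverts T = insert r W" "r \<notin> W"
    by (rule rooted_at_leaf)
  then show ?thesis
    using branch_degree_sum[OF r(2)] branch_finite[OF r(2)] by (simp add: card_parcs)
qed

lemma leaves_eq: "leaves T = {v \<in> pverts T. card (neighbours T v) = 1}"
  by (simp add: leaves_def out_degree_eq_card_neighbours)

lemma finite_leaves: "finite (leaves T)"
  using pair_finite_verts by (simp add: leaves_def)

text \<open>
  The degrees add up to \<open>2 (n - 1)\<close>, and to \<open>3 n - 2 |L|\<close> because the leaves have degree 1 and the
  other vertices degree 3.
\<close>

lemma card_leaves: "2 * card (leaves T) = card (pverts T) + 2"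
proof -
  let ?I = "pverts T - leaves T"
  have sub: "leaves T \<subseteq> pverts T" by (auto simp: leaves_def)
  have "card (parcs T) = (\<Sum>u\<in>?I. card (neighbours T u)) + (\<Sum>u\<in>leaves T. card (neighbours T u))"
    unfolding card_parcs using sub pair_finite_verts by (intro sum.subset_diff)
  also have "(\<Sum>u\<in>leaves T. card (neighbours T u)) = card (leaves T)"
    by (simp add: leaves_eq)
  also have "(\<Sum>u\<in>?I. card (neighbours T u)) = (\<Sum>u\<in>?I. 3)"
    using degree by (intro sum.cong) (auto simp: leaves_eq)
  finally show ?thesis
    using card_arcs card_Diff_subset[OF finite_leaves sub] card_mono[OF pair_finite_verts sub] by simp
qed

text \<open>
  The set \<open>I\<close> constructed from the rooted tree matches the lower bound, and by that bound no
  independent set of internal vertices is larger.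
\<close>

theorem zero_forcing_number_eq:
  obtains S where "independent_set T S" "S \<inter> leaves T = {}" "zero_forcing_number T = card S + 1"
    "\<And>S'. independent_set T S' \<Longrightarrow> S' \<inter> leaves T = {} \<Longrightarrow> card S' \<le> card S"
proof -
  obtain r c W where r: "neighbours T r = {c}" "branch T r c W" "pverts T = insert r W"
    by (rule rooted_at_leaf)
  obtain S B where SB: "internal_independent S" "zero_forcing_set T B" "card B \<le> card S + 1"
    using rooted_tree_zero_forcing[OF r] by blast
  obtain Z where Z: "zero_forcing_set T Z" "card Z = zero_forcing_number T"
    by (rule zero_forcing_number_attained)
  have bound: "card S' + 1 \<le> zero_forcing_number T"
    if "independent_set T S'" "S' \<inter> leaves T = {}" for S'
  proof -
    have "3 \<le> card (neighbours T s)" if "s \<in> S'" for s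
    proof -
      have "s \<in> pverts T" "s \<notin> leaves T"
        using that \<open>independent_set T S'\<close> \<open>S' \<inter> leaves T = {}\<close> by (auto simp: independent_set_def)
      then show ?thesis using degree[of s] by (auto simp: leaves_eq)
    qed
    from independent_degree_three_bound[OF Z(1) that(1) this] show ?thesis
      using card_arcs Z(2) by linarith
  qed
  have S: "independent_set T S" "S \<inter> leaves T = {}"
    using SB(1) by (auto simp: internal_independent_def leaves_eq)
  moreover have eq: "zero_forcing_number T = card S + 1"
    using bound[OF S] zero_forcing_number_le[OF SB(2)] SB(3) by linarith
  ultimately show thesis using that bound by force
qed

end

section \<open>Replacing the leaves\<close>

definition gadget :: "'a \<Rightarrow> 'a repl_vertex set" where
  "gadget l = {Attach l, VA l, VB l, VC l, VD l}"

locale leaf_replacement = pair_graph T for T :: "'a pair_pre_digraph"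
begin

abbreviation H :: "'a repl_vertex pair_pre_digraph" where
  "H \<equiv> replace_leaves T"

abbreviation L :: "'a set" where
  "L \<equiv> leaves T"

sublocale H: pair_graph H
  using pair_graph_replace_leaves pair_graph by blast

lemma L_subset: "L \<subseteq> pverts T" and finite_L: "finite L"
  using pair_finite_verts by (auto simp: leaves_def)

lemma tree_place_simps [simp]:
  "l \<in> L \<Longrightarrow> tree_place T l = Attach l" "v \<notin> L \<Longrightarrow> tree_place T v = Kept v"
  by (auto simp: tree_place_def)

lemma tree_place_distinct [simp]:
  "tree_place T v \<noteq> VA l" "tree_place T v \<noteq> VB l" "tree_place T v \<noteq> VC l" "tree_place T v \<noteq> VD l"
  "VA l \<noteq> tree_place T v" "VB l \<noteq> tree_place T v" "VC l \<noteq> tree_place T v" "VD l \<noteq> tree_place T v"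
  "Attach l = tree_place T v \<longleftrightarrow> v = l \<and> l \<in> L"
  "Kept u = tree_place T v \<longleftrightarrow> v = u \<and> u \<notin> L"
  by (auto simp: tree_place_def)

lemma pverts_H: "pverts H = Kept ` (pverts T - L) \<union> (\<Union>l\<in>L. gadget l)"
  using L_subset by (auto simp: replace_leaves_def gadget_def tree_place_def)

lemma tree_place_in_H: "v \<in> pverts T \<Longrightarrow> tree_place T v \<in> pverts H"
  by (auto simp: replace_leaves_def)

lemma arcs_H:
  "(a, b) \<in> parcs H \<longleftrightarrow> (\<exists>u v. (u, v) \<in> parcs T \<and> a = tree_place T u \<and> b = tree_place T v)
     \<or> (\<exists>l\<in>L. (a, b) \<in> gadget_arcs l \<or> (b, a) \<in> gadget_arcs l)"
  by (auto simp: replace_leaves_def)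

lemma neighbours_gadget:
  assumes "l \<in> L"
  shows "neighbours H (VA l) = {Attach l, VC l, VD l}"
    and "neighbours H (VB l) = {Attach l, VC l, VD l}"
    and "neighbours H (VC l) = {VA l, VB l, VD l}"
    and "neighbours H (VD l) = {VA l, VB l, VC l}"
    and "neighbours H (Attach l) = {VA l, VB l} \<union> tree_place T ` neighbours T l"
  using assms unfolding neighbours_def arcs_H gadget_arcs_def by auto

lemma neighbours_Kept: "v \<notin> L \<Longrightarrow> neighbours H (Kept v) = tree_place T ` neighbours T v"
  unfolding neighbours_def arcs_H gadget_arcs_def by auto

lemma card_by_gadgets:
  assumes "X \<subseteq> pverts H"
  shows "card X = card {v \<in> pverts T - L. Kept v \<in> X} + (\<Sum>l\<in>L. card (X \<inter> gadget l))"
proof -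
  let ?K = "{v \<in> pverts T - L. Kept v \<in> X}"
  have "X = Kept ` ?K \<union> (\<Union>l\<in>L. X \<inter> gadget l)"
    using assms by (auto simp: pverts_H)
  also have "card \<dots> = card (Kept ` ?K) + card (\<Union>l\<in>L. X \<inter> gadget l)"
    using pair_finite_verts finite_L by (intro card_Un_disjoint) (auto simp: gadget_def)
  also have "card (Kept ` ?K) = card ?K"
    by (intro card_image) (auto simp: inj_on_def)
  also have "card (\<Union>l\<in>L. X \<inter> gadget l) = (\<Sum>l\<in>L. card (X \<inter> gadget l))"
    using finite_L by (intro card_UN_disjoint) (auto simp: gadget_def)
  finally show ?thesis .
qed

text \<open>
  With \<open>VA l\<close> and \<open>VC l\<close> blue, \<open>Attach l\<close> becoming blue makes the whole gadget blue, so that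
  \<open>Attach l\<close> is again free to force the outside neighbour. Thus a stalled set of the new graph
  that contains these vertices restricts to a stalled set of the tree.
\<close>

lemma zero_forcing_set_replace_leaves:
  assumes "zero_forcing_set T B"
  shows "zero_forcing_set H (tree_place T ` B \<union> VA ` L \<union> VC ` L)"
  unfolding H.zero_forcing_set_iff_stalled
proof (intro conjI allI impI)
  have B: "B \<subseteq> pverts T" using assms by (simp add: zero_forcing_set_def)
  then show "tree_place T ` B \<union> VA ` L \<union> VC ` L \<subseteq> pverts H"
    using tree_place_in_H by (auto simp: pverts_H gadget_def)
  fix C assume C: "stalled H C" "tree_place T ` B \<union> VA ` L \<union> VC ` L \<subseteq> C"
  have gadget_full: "gadget l \<subseteq> C" if l: "l \<in> L" "Attach l \<in> C" for l
  proof -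
    have a: "VA l \<in> C" and c: "VC l \<in> C" using C(2) l(1) by auto
    have d: "VD l \<in> C"
      using C(1) a by (rule stalled_forces) (use l c in \<open>auto simp: neighbours_gadget\<close>)
    have "VB l \<in> C"
      using C(1) c by (rule stalled_forces) (use l a d in \<open>auto simp: neighbours_gadget\<close>)
    with a c d l show ?thesis by (simp add: gadget_def)
  qed
  let ?D = "{v \<in> pverts T. tree_place T v \<in> C}"
  have "stalled T ?D"
    unfolding stalled_def
  proof (intro conjI ballI allI notI)
    fix v w assume v: "v \<in> ?D" and w: "neighbours T v - ?D = {w}"
    have "tree_place T w \<in> C"
    proof (rule stalled_forces[OF C(1)])
      show vC: "tree_place T v \<in> C" using v by simp
      have rest: "tree_place T ` neighbours T v - {tree_place T w} \<subseteq> C" using w by auto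
      show "tree_place T w \<in> neighbours H (tree_place T v)"
        using w by (cases "v \<in> L") (auto simp: neighbours_gadget neighbours_Kept)
      show "neighbours H (tree_place T v) - {tree_place T w} \<subseteq> C"
        using rest gadget_full[of v] vC
        by (cases "v \<in> L") (auto simp: neighbours_gadget neighbours_Kept gadget_def)
    qed
    then show False using w neighbours_subset[of v] by auto
  qed auto
  moreover have "B \<subseteq> ?D" using B C(2) by auto
  ultimately have D: "?D = pverts T"
    using assms zero_forcing_set_iff_stalled by blast
  then have "Kept ` (pverts T - L) \<subseteq> C" by force
  moreover have "gadget l \<subseteq> C" if "l \<in> L" for l
  proof (rule gadget_full[OF that])
    have "l \<in> ?D" using that L_subset D by auto
    then show "Attach l \<in> C" using that by simp
  qed
  ultimately show "C = pverts H" using C(1) by (auto simp: stalled_def pverts_H)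
qed

text \<open>
  Each of the two pairs consists of vertices with the same neighbours apart from each other, and
  such a pair is a fort.
\<close>

lemma zero_forcing_set_meets_twins:
  assumes "zero_forcing_set H B" "l \<in> L"
  shows "B \<inter> {VA l, VB l} \<noteq> {}" and "B \<inter> {VC l, VD l} \<noteq> {}"
proof -
  have twins: "B \<inter> {a, b} \<noteq> {}"
    if ab: "{a, b} \<subseteq> pverts H" "a \<noteq> b" "neighbours H a - {b} = neighbours H b - {a}" for a b
  proof (rule H.zero_forcing_set_meets_fort[OF assms(1) ab(1)])
    fix u w assume u: "u \<in> pverts H - {a, b}"
    have "a \<in> neighbours H u \<longleftrightarrow> u \<in> neighbours H a - {b}"
      using u H.neighbours_sym[of a u] by simp
    also have "\<dots> \<longleftrightarrow> b \<in> neighbours H u"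
      unfolding ab(3) using u H.neighbours_sym[of b u] by simp
    finally show "neighbours H u \<inter> {a, b} \<noteq> {w}"
      using ab(2) by (cases "b \<in> neighbours H u") (auto simp: Int_insert_right)
  qed simp
  show "B \<inter> {VA l, VB l} \<noteq> {}"
    by (rule twins) (use assms(2) in \<open>auto simp: pverts_H gadget_def neighbours_gadget\<close>)
  show "B \<inter> {VC l, VD l} \<noteq> {}"
    by (rule twins) (use assms(2) in \<open>auto simp: pverts_H gadget_def neighbours_gadget\<close>)
qed

lemma zero_forcing_set_in_gadget:
  assumes "zero_forcing_set H B" "l \<in> L"
  shows "2 \<le> card (B \<inter> gadget l)"
    and "card (B \<inter> gadget l) < 3 \<Longrightarrow>
      Attach l \<notin> B \<and> (VA l \<in> B \<longleftrightarrow> VB l \<notin> B) \<and> (VC l \<in> B \<longleftrightarrow> VD l \<notin> B)"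
proof -
  have "card (B \<inter> gadget l) = of_bool (Attach l \<in> B) + of_bool (VA l \<in> B) + of_bool (VB l \<in> B)
      + of_bool (VC l \<in> B) + of_bool (VD l \<in> B)"
    by (simp add: gadget_def Int_insert_right)
  then show "2 \<le> card (B \<inter> gadget l)"
    and "card (B \<inter> gadget l) < 3 \<Longrightarrow>
      Attach l \<notin> B \<and> (VA l \<in> B \<longleftrightarrow> VB l \<notin> B) \<and> (VC l \<in> B \<longleftrightarrow> VD l \<notin> B)"
    using zero_forcing_set_meets_twins[OF assms]
    by (cases "Attach l \<in> B"; cases "VA l \<in> B"; cases "VB l \<in> B"; cases "VC l \<in> B";
        cases "VD l \<in> B"; simp)+
qed

text \<open>
  A stalled proper subset \<open>C\<close> of the tree that contains the contracted set would give a fort of the new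
  graph disjoint from \<open>B\<close>: take the vertices outside \<open>C\<close>, and for each leaf outside \<open>C\<close>
  all of its gadget that is not in \<open>B\<close>. Of such a gadget, \<open>B\<close> contains exactly one vertex from each
  pair of twins and nothing else. So its attaching vertex is in the fort and plays the role of
  the leaf, and the two vertices in \<open>B\<close> each see at least two vertices of the fort.
\<close>

lemma zero_forcing_set_contract:
  assumes B: "zero_forcing_set H B"
  shows "zero_forcing_set T ({v \<in> pverts T - L. Kept v \<in> B} \<union> {l \<in> L. 3 \<le> card (B \<inter> gadget l)})"
    (is "zero_forcing_set T ?B")
  unfolding zero_forcing_set_iff_stalled
proof (intro conjI allI impI)
  show "?B \<subseteq> pverts T" using L_subset by auto
  fix C assume C: "stalled T C" "?B \<subseteq> C"
  show "C = pverts T"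
  proof (rule ccontr)
    assume "C \<noteq> pverts T"
    then obtain z where z: "z \<in> pverts T" "z \<notin> C" using C(1) by (auto simp: stalled_def)
    define F where "F = Kept ` (pverts T - C - L) \<union> (\<Union>l\<in>L - C. gadget l - B)"
    have light: "Attach l \<notin> B \<and> (VA l \<in> B \<longleftrightarrow> VB l \<notin> B) \<and> (VC l \<in> B \<longleftrightarrow> VD l \<notin> B)"
      if l: "l \<in> L" "l \<notin> C" for l
    proof (rule zero_forcing_set_in_gadget(2)[OF B l(1)])
      show "card (B \<inter> gadget l) < 3" using C(2) l by (auto simp: not_less[symmetric])
    qed
    have F_gadget: "x \<in> F \<longleftrightarrow> l \<notin> C \<and> x \<notin> B" if "l \<in> L" "x \<in> gadget l" for l x
      using that by (auto simp: F_def gadget_def)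
    have F_Kept: "Kept v \<in> F \<longleftrightarrow> v \<in> pverts T - C - L" for v
      by (auto simp: F_def gadget_def)
    have place: "tree_place T v \<in> F \<longleftrightarrow> v \<notin> C" if "v \<in> pverts T" for v
    proof (cases "v \<in> L")
      case True
      then show ?thesis using F_gadget[OF True, of "Attach v"] light[OF True] by (auto simp: gadget_def)
    next
      case False
      then show ?thesis using F_Kept that by simp
    qed
    have place_nb: "tree_place T ` neighbours T v \<inter> F = tree_place T ` (neighbours T v - C)" for v
      using neighbours_subset[of v] place by auto
    have no_single: "tree_place T ` (neighbours T v - C) \<noteq> {w}" if "v \<in> C" for v w
    proof
      assume eq: "tree_place T ` (neighbours T v - C) = {w}"
      then obtain w' where w': "w' \<in> neighbours T v - C" "tree_place T w' = w" by blast
      have "x = w'" if "x \<in> neighbours T v - C" for x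
      proof -
        have "tree_place T x \<in> {w}" using that eq by blast
        then show ?thesis using w'(2) by auto
      qed
      then have "neighbours T v - C = {w'}" using w'(1) by blast
      then show False using C(1) that unfolding stalled_def by blast
    qed
    have "B \<inter> F \<noteq> {}"
    proof (rule H.zero_forcing_set_meets_fort[OF B])
      show "F \<subseteq> pverts H" by (auto simp: F_def pverts_H)
      show "F \<noteq> {}" using place[OF z(1)] z(2) by blast
      fix u w assume u: "u \<in> pverts H - F"
      consider (kept) v where "u = Kept v" "v \<in> pverts T" "v \<notin> L"
        | (in_gadget) l where "u \<in> gadget l" "l \<in> L"
        using u by (auto simp: pverts_H)
      then show "neighbours H u \<inter> F \<noteq> {w}"
      proof cases
        case kept
        then have "v \<in> C" using u F_Kept by auto
        then show ?thesis using no_single neighbours_Kept[OF kept(3)] place_nb kept(1) by simp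
      next
        case in_gadget
        show ?thesis
        proof (cases "l \<in> C")
          case True
          then have out: "x \<notin> F" if "x \<in> gadget l" for x
            using F_gadget[OF in_gadget(2) that] by simp
          show ?thesis
          proof (cases "u = Attach l")
            case u_eq: True
            have "neighbours H u \<inter> F = tree_place T ` neighbours T l \<inter> F"
              using out[of "VA l"] out[of "VB l"] unfolding u_eq neighbours_gadget(5)[OF in_gadget(2)]
              by (auto simp: gadget_def)
            then show ?thesis using no_single[OF True] place_nb by simp
          next
            case False
            then have "neighbours H u \<subseteq> gadget l"
              using in_gadget by (auto simp: gadget_def neighbours_gadget)
            then have "neighbours H u \<inter> F = {}" using out by blast
            then show ?thesis by simp
          qed
        next
          case False
          note F = F_gadget[OF in_gadget(2)] light[OF in_gadget(2) False]
          have FA: "Attach l \<in> F"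
            using F False by (simp add: gadget_def)
          have FAB: "VA l \<in> F \<longleftrightarrow> VB l \<notin> F" and FCD: "VC l \<in> F \<longleftrightarrow> VD l \<notin> F"
            using F(2) F(1)[of "VA l"] F(1)[of "VB l"] F(1)[of "VC l"] F(1)[of "VD l"] False
            by (simp_all add: gadget_def)
          obtain a b where "a \<noteq> b" "a \<in> neighbours H u \<inter> F" "b \<in> neighbours H u \<inter> F"
          proof -
            consider (ab) "u = VA l \<or> u = VB l" | (c) "u = VC l" "VD l \<in> F" | (d) "u = VD l" "VC l \<in> F"
              using in_gadget(1) u FA FCD by (auto simp: gadget_def)
            then show thesis
            proof cases
              case ab
              then have nb: "neighbours H u = {Attach l, VC l, VD l}"
                using in_gadget(2) by (auto simp: neighbours_gadget)
              show thesis
                using that[of "Attach l" "if VC l \<in> F then VC l else VD l"] FA FCD by (simp add: nb)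
            next
              case c
              show thesis
                using that[of "VD l" "if VA l \<in> F then VA l else VB l"] FAB c in_gadget(2)
                by (simp add: neighbours_gadget)
            next
              case d
              show thesis
                using that[of "VC l" "if VA l \<in> F then VA l else VB l"] FAB d in_gadget(2)
                by (simp add: neighbours_gadget)
            qed
          qed
          then show ?thesis by (metis singletonD)
        qed
      qed
    qed
    moreover have "B \<inter> F = {}" using C(2) by (auto simp: F_def)
    ultimately show False by simp
  qed
qed

theorem zero_forcing_number_replace_leaves:
  "zero_forcing_number H = zero_forcing_number T + 2 * card L"
proof (rule antisym)
  obtain B where B: "zero_forcing_set T B" "card B = zero_forcing_number T"
    by (rule zero_forcing_number_attained)
  have "card (tree_place T ` B \<union> VA ` L \<union> VC ` L) \<le> card (tree_place T ` B) + card (VA ` L) + card (VC ` L)"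
    by (meson add_mono_thms_linordered_semiring(3) card_Un_le order_trans)
  also have "\<dots> = card B + 2 * card L"
    by (simp add: card_image inj_on_def)
  finally show "zero_forcing_number H \<le> zero_forcing_number T + 2 * card L"
    using H.zero_forcing_number_le[OF zero_forcing_set_replace_leaves[OF B(1)]] B(2) by linarith
next
  obtain B where B: "zero_forcing_set H B" "card B = zero_forcing_number H"
    by (rule H.zero_forcing_number_attained)
  let ?K = "{v \<in> pverts T - L. Kept v \<in> B}" and ?heavy = "{l \<in> L. 3 \<le> card (B \<inter> gadget l)}"
  \<comment> \<open>Each gadget carries at least two vertices of \<open>B\<close>, and a heavy one at least three.\<close>
  have "(\<Sum>l\<in>L. of_bool (3 \<le> card (B \<inter> gadget l))) = card ?heavy"
    using finite_L by (simp add: sum_of_bool_eq Collect_conj_eq)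
  then have "card ?heavy + 2 * card L = (\<Sum>l\<in>L. of_bool (3 \<le> card (B \<inter> gadget l)) + 2)"
    by (simp only: sum.distrib sum_constant mult.commute of_nat_id)
  also have "\<dots> \<le> (\<Sum>l\<in>L. card (B \<inter> gadget l))"
  proof (rule sum_mono)
    fix l assume "l \<in> L"
    from zero_forcing_set_in_gadget(1)[OF B(1) this]
    show "of_bool (3 \<le> card (B \<inter> gadget l)) + 2 \<le> card (B \<inter> gadget l)"
      by (cases "3 \<le> card (B \<inter> gadget l)") simp_all
  qed
  finally have "card (?K \<union> ?heavy) + 2 * card L \<le> card B"
    using card_Un_le[of ?K ?heavy] card_by_gadgets[of B] B(1) by (simp add: zero_forcing_set_def)
  then show "zero_forcing_number T + 2 * card L \<le> zero_forcing_number H"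
    using zero_forcing_number_le[OF zero_forcing_set_contract[OF B(1)]] B(2) by linarith
qed

text \<open>
  A gadget contributes two vertices at most, and \<open>VA l, VB l\<close> contribute two without touching a
  vertex of the tree. Therefore the leaves do not interact with the choice of internal vertices.
\<close>

theorem independence_number_replace_leaves:
  assumes S: "independent_set T S" "S \<inter> L = {}"
    and max: "\<And>S'. independent_set T S' \<Longrightarrow> S' \<inter> L = {} \<Longrightarrow> card S' \<le> card S"
  shows "independence_number H = card S + 2 * card L"
  unfolding independence_number_def
proof (rule Max_eqI)
  show "finite (card ` {X. independent_set H X})" using H.finite_independent_sets by simp
next
  fix k assume "k \<in> card ` {X. independent_set H X}"
  then obtain X where X: "independent_set H X" "k = card X" by auto
  let ?K = "{v \<in> pverts T - L. Kept v \<in> X}"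
  have indep: "y \<notin> X" if "x \<in> X" "y \<in> neighbours H x" for x y
    using X(1) that by (auto simp: independent_set_def neighbours_def)
  have "(u, v) \<notin> parcs T" if "u \<in> ?K" "v \<in> ?K" for u v
  proof
    assume "(u, v) \<in> parcs T"
    then have "tree_place T v \<in> tree_place T ` neighbours T u" by (simp add: neighbours_def)
    then show False using that indep[of "Kept u" "Kept v"] by (simp add: neighbours_Kept)
  qed
  then have "independent_set T ?K" by (auto simp: independent_set_def)
  then have "card ?K \<le> card S" by (rule max) auto
  moreover have "card (X \<inter> gadget l) \<le> 2" if "l \<in> L" for l
  proof -
    have "card (X \<inter> gadget l) = of_bool (Attach l \<in> X) + of_bool (VA l \<in> X) + of_bool (VB l \<in> X)
        + of_bool (VC l \<in> X) + of_bool (VD l \<in> X)"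
      by (simp add: gadget_def Int_insert_right)
    moreover have "{Attach l, VC l, VD l} \<inter> X = {}" if "VA l \<in> X \<or> VB l \<in> X"
      using that indep neighbours_gadget(1,2)[OF \<open>l \<in> L\<close>] by blast
    moreover have "VD l \<notin> X" if "VC l \<in> X"
      using that indep neighbours_gadget(3)[OF \<open>l \<in> L\<close>] by blast
    ultimately show ?thesis
      by (cases "Attach l \<in> X"; cases "VA l \<in> X"; cases "VB l \<in> X"; cases "VC l \<in> X"; simp)
  qed
  then have "(\<Sum>l\<in>L. card (X \<inter> gadget l)) \<le> card L * 2"
    using sum_bounded_above[of L "\<lambda>l. card (X \<inter> gadget l)" 2] by simp
  ultimately show "k \<le> card S + 2 * card L"
    using card_by_gadgets[of X] X by (simp add: independent_set_def)
next
  let ?X = "Kept ` S \<union> VA ` L \<union> VB ` L"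
  have fin: "finite S" using S(1) pair_finite_verts by (auto simp: independent_set_def intro: finite_subset)
  have nS: "s \<notin> L" if "s \<in> S" for s using S(2) that by blast
  have "?X \<inter> neighbours H x = {}" if "x \<in> ?X" for x
    using that S(1) nS by (auto simp: neighbours_Kept neighbours_gadget) (auto simp: independent_set_def neighbours_def)
  then have "(x, y) \<notin> parcs H" if "x \<in> ?X" "y \<in> ?X" for x y
    using that unfolding neighbours_def by blast
  moreover have "?X \<subseteq> pverts H"
    using S(1) nS by (auto simp: independent_set_def pverts_H gadget_def)
  ultimately have "independent_set H ?X"
    unfolding independent_set_def by blast
  moreover have "card ?X = card S + 2 * card L"
    using fin finite_L by (subst card_Un_disjoint card_Un_disjoint; auto simp: card_image inj_on_def)+
  ultimately show "card S + 2 * card L \<in> card ` {X. independent_set H X}"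
    by (intro image_eqI[of _ _ ?X]) auto
qed

end

section \<open>Zero forcing and independence after the replacement\<close>

theorem theorem15:
  fixes T :: "'a pair_pre_digraph" and n :: nat
  assumes "three_one_tree T"
    and "card (pverts T) = n"
  shows "zero_forcing_number (replace_leaves T) = zero_forcing_number T + n + 2
    \<and> zero_forcing_number T + n + 2 = independence_number (replace_leaves T) + 1"
proof -
  interpret three_one T using assms(1) by unfold_locales
  interpret leaf_replacement T ..
  obtain S where S: "independent_set T S" "S \<inter> leaves T = {}" "zero_forcing_number T = card S + 1"
    "\<And>S'. independent_set T S' \<Longrightarrow> S' \<inter> leaves T = {} \<Longrightarrow> card S' \<le> card S"
    by (rule zero_forcing_number_eq) blast
  have "independence_number (replace_leaves T) = card S + 2 * card (leaves T)"
    by (rule independence_number_replace_leaves[OF S(1,2,4)])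
  then show ?thesis
    using zero_forcing_number_replace_leaves card_leaves assms(2) S(3) by simp
qed

end
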